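(* Let $n\ge 1$, let $T>0$, let $G \in \mathcal{G}^n$, and let $\mathcal{K} : \mathcal{G}^n \to 2^{\mathbb{S}^n}$ be a set-valued map such that $\mathcal{K}(H)$ is a nonempty subset of $\mathcal{Q}(H)$ for every $H \in \mathcal{G}^n$. Let $X \in \mathcal{K}(G)$ and $x_0 \in \mathbb{R}^{n}$, and define $$P := \int_0^{T} e^{Xt} x_0 x_0^\top e^{Xt}\, dt, \qquad Q := x_T x_T^\top - x_0 x_0^\top, \qquad x_T := e^{XT}x_0.$$ Then the network reconstruction problem is solvable for $(x_0,X,\mathcal{K})$ if and only if there exists a unique matrix $S$ satisfying $$SP + PS = Q, \quad S \in \operatorname{im} \mathcal{K}.$$ Moreover, under this condition, we have $S = X$.
   Context: $\mathbb{S}^n$ is the set of real symmetric $n\times n$ matrices. $\mathcal{G}^n$ is the set of simple undirected graphs (no self-loops, at most one edge between any pair of vertices) with vertex set $V=\{1,\dots,n\}$. For $G\in\mathcal{G}^n$ with edge set $E$, the qualitative class is $\mathcal{Q}(G) := \{X \in \mathbb{S}^n \mid \text{for all } i \neq j,\ X_{ij} \neq 0 \iff (i,j) \in E\}$. The image of a set-valued map $\mathcal{K} : \mathcal{G}^n \to 2^{\mathbb{S}^n}$ is $\operatorname{im}\mathcal{K} := \{Y \in \mathbb{S}^n \mid \exists\, G\in\mathcal{G}^n \text{ such that } Y \in \mathcal{K}(G)\}$. Solvability: for $x_0\in\mathbb{R}^n$ and $X\in\operatorname{im}\mathcal{K}$, let $x_{x_0}(t)=e^{Xt}x_0$ be the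 solution of $\dot x(t)=Xx(t)$ for $t\ge 0$, $x(0)=x_0$. The network reconstruction problem is said to be solvable for $(x_0,X,\mathcal{K})$ if for every $\bar X\in\operatorname{im}\mathcal{K}$ such that $x_{x_0}(\cdot)$ is a solution to $\dot x(t)=\bar X x(t)$ for $t\in[0,T]$, we have $\bar X=X$. Here $T>0$ is a fixed real number (the same $T$ as in the definition of $P$ and $Q$). *)

theory Defs
  imports "HOL-Analysis.Analysis"
begin

text \<open>
  The vertex set \<open>{1,\<dots>,n}\<close> is rendered by a finite type \<open>'n\<close> (\<open>n = CARD('n) \<ge> 1\<close>), and a simple
  undirected graph by its symmetric, irreflexive set of ordered pairs of adjacent vertices.
\<close>

definition simple_graphs :: "('n::finite \<times> 'n) set set" where
  "simple_graphs = {E. sym E \<and> irrefl E}"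

definition symmetric_matrices :: "(real^'n^'n) set" where
  "symmetric_matrices = {X. transpose X = X}"

definition qualitative_class :: "('n::finite \<times> 'n) set \<Rightarrow> (real^'n^'n) set" where
  "qualitative_class E =
     {X \<in> symmetric_matrices. \<forall>i j. i \<noteq> j \<longrightarrow> (X $ i $ j \<noteq> 0 \<longleftrightarrow> (i, j) \<in> E)}"

definition im :: "(('n::finite \<times> 'n) set \<Rightarrow> (real^'n^'n) set) \<Rightarrow> (real^'n^'n) set" where
  "im K = {Y \<in> symmetric_matrices. \<exists>G\<in>simple_graphs. Y \<in> K G}"

text \<open>
  The operations \<open>*\<close> and \<open>^\<close> act componentwise on the type \<open>real^'n^'n\<close>, which moreover is not an
  instance of the class required by \<open>exp\<close>; matrix powers and the exponential are therefore
  built from \<open>**\<close>.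
\<close>

definition mat_power :: "real^'n^'n \<Rightarrow> nat \<Rightarrow> real^'n^'n" where
  "mat_power A k = (((**) A) ^^ k) (mat 1)"

definition mat_exp :: "real^'n^'n \<Rightarrow> real^'n^'n" where
  "mat_exp A = (\<Sum>k. mat_power A k /\<^sub>R fact k)"

lemma abs_mat_power_le:
  fixes A :: "real^'n^'n"
  shows "\<bar>mat_power A k $ i $ j\<bar> \<le> (\<Sum>i\<in>UNIV. \<Sum>j\<in>UNIV. \<bar>A $ i $ j\<bar>) ^ k"
proof (induction k arbitrary: i j)
  case 0
  then show ?case by (simp add: mat_power_def mat_def)
next
  case (Suc k)
  let ?B = "\<Sum>i\<in>UNIV. \<Sum>j\<in>UNIV. \<bar>A $ i $ j\<bar>"
  have row: "(\<Sum>l\<in>UNIV. \<bar>A $ i $ l\<bar>) \<le> ?B"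
    by (rule member_le_sum[where f = "\<lambda>i. \<Sum>l\<in>UNIV. \<bar>A $ i $ l\<bar>"]) (auto intro: sum_nonneg)
  have nonneg: "0 \<le> ?B ^ k"
    by (intro zero_le_power sum_nonneg) auto
  have "\<bar>mat_power A (Suc k) $ i $ j\<bar> = \<bar>\<Sum>l\<in>UNIV. A $ i $ l * mat_power A k $ l $ j\<bar>"
    by (simp add: mat_power_def matrix_matrix_mult_def)
  also have "\<dots> \<le> (\<Sum>l\<in>UNIV. \<bar>A $ i $ l\<bar> * \<bar>mat_power A k $ l $ j\<bar>)"
    by (rule order_trans[OF sum_abs]) (simp add: abs_mult)
  also have "\<dots> \<le> (\<Sum>l\<in>UNIV. \<bar>A $ i $ l\<bar> * ?B ^ k)"
    by (intro sum_mono mult_left_mono Suc.IH) auto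
  also have "\<dots> = (\<Sum>l\<in>UNIV. \<bar>A $ i $ l\<bar>) * ?B ^ k"
    by (simp add: sum_distrib_right)
  also have "\<dots> \<le> ?B * ?B ^ k"
    by (rule mult_right_mono[OF row nonneg])
  finally show ?case by simp
qed

lemma mat_exp_sums:
  fixes A :: "real^'n^'n"
  shows "(\<lambda>k. mat_power A k /\<^sub>R fact k) sums mat_exp A"
proof -
  let ?B = "\<Sum>i\<in>UNIV. \<Sum>j\<in>UNIV. \<bar>A $ i $ j\<bar>"
  have "summable (\<lambda>k. (mat_power A k /\<^sub>R fact k) $ i $ j)" for i j
  proof (rule summable_comparison_test'[OF summable_exp[of ?B]])
    show "norm ((mat_power A k /\<^sub>R fact k) $ i $ j) \<le> inverse (fact k) * ?B ^ k" for k
      using abs_mat_power_le[of A k i j]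
      by (simp add: abs_mult mult_left_mono)
  qed
  then have "(\<lambda>k. mat_power A k /\<^sub>R fact k) sums
      (\<chi> i j. \<Sum>k. (mat_power A k /\<^sub>R fact k) $ i $ j)"
    unfolding sums_def
    by (intro vec_tendstoI) (simp add: summable_LIMSEQ del: vector_scaleR_component)
  then show ?thesis
    unfolding mat_exp_def by (simp add: sums_iff)
qed

definition outer :: "real^'n \<Rightarrow> real^'n \<Rightarrow> real^'n^'n" where
  "outer v w = (\<chi> i j. v $ i * w $ j)"

definition trajectory :: "real^'n^'n \<Rightarrow> real^'n \<Rightarrow> real \<Rightarrow> real^'n" where
  "trajectory X x0 t = mat_exp (t *\<^sub>R X) *v x0"

definition solves_on :: "(real \<Rightarrow> real^'n) \<Rightarrow> real^'n^'n \<Rightarrow> real set \<Rightarrow> bool" where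
  "solves_on x A I \<longleftrightarrow> (\<forall>t\<in>I. (x has_vector_derivative A *v x t) (at t within I))"

definition solvable ::
    "real \<Rightarrow> real^'n::finite \<Rightarrow> real^'n^'n \<Rightarrow> (('n \<times> 'n) set \<Rightarrow> (real^'n^'n) set) \<Rightarrow> bool" where
  "solvable T x0 X K \<longleftrightarrow>
     (\<forall>X'\<in>im K. solves_on (trajectory X x0) X' {0..T} \<longrightarrow> X' = X)"

end

theory Submission
  imports Defs
begin

text \<open>
  Since \<open>X\<close> is symmetric, so is \<open>exp (t X)\<close>, and \<open>P\<close> is the Gramian \<open>\<integral> x x\<^sup>T\<close> of the trajectory \<open>x\<close>.
  If \<open>x\<close> also solves \<open>x' = A x\<close> with \<open>A\<close> symmetric, integrating \<open>(x x\<^sup>T)' = A x x\<^sup>T + x x\<^sup>T A\<close> gives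
  \<open>A P + P A = Q\<close>. Conversely, if \<open>S P + P S = Q\<close>, then \<open>D = S - X\<close> satisfies \<open>D P + P D = 0\<close>, and the
  Frobenius product with \<open>D\<close> yields \<open>0 = 2 \<integral> \<bar>D x\<bar>\<^sup>2\<close>. Hence \<open>D x = 0\<close> on \<open>[0,T]\<close>, so \<open>x\<close> solves the
  system of \<open>S\<close>. Thus the solutions \<open>S \<in> im K\<close> of the Lyapunov equation are exactly the matrices in
  \<open>im K\<close> which \<open>x\<close> does not distinguish from \<open>X\<close>.
\<close>

lemma mat_power_Suc: "mat_power A (Suc k) = A ** mat_power A k"
  by (simp add: mat_power_def)

text \<open>Transposition reverses the two factors of \<open>mat_power A (Suc k)\<close>; for
  symmetric \<open>A\<close> this restores their order.\<close>

lemma mat_power_commute: "A ** mat_power A k = mat_power A k ** A"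
proof (induction k)
  case 0
  then show ?case by (simp add: mat_power_def)
next
  case (Suc k)
  then show ?case
    by (metis mat_power_Suc matrix_mul_assoc)
qed

lemma mat_power_scaleR: "mat_power (t *\<^sub>R A) k = t ^ k *\<^sub>R mat_power A k"
proof (induction k)
  case 0
  then show ?case by (simp add: mat_power_def)
next
  case (Suc k)
  then show ?case
    by (simp add: mat_power_Suc matrix_scalar_ac scalar_matrix_assoc[symmetric] mult.commute)
qed

lemma transpose_mat_power:
  fixes A :: "real^'n^'n"
  assumes "transpose A = A"
  shows "transpose (mat_power A k) = mat_power A k"
proof (induction k)
  case 0
  then show ?case by (simp add: mat_power_def)
next
  case (Suc k)
  then show ?case
    by (simp add: mat_power_Suc matrix_transpose_mul assms mat_power_commute)
qed

lemma linear_transpose: "linear (transpose :: real^'n^'m \<Rightarrow> real^'m^'n)"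
  by (rule linearI) (simp_all add: transpose_def vec_eq_iff)

text \<open>Transposition is bounded linear, so it passes through the exponential series, whose
  terms are all symmetric.\<close>

lemma transpose_mat_exp:
  fixes A :: "real^'n^'n"
  assumes "transpose A = A"
  shows "transpose (mat_exp A) = mat_exp A"
proof -
  have "(\<lambda>k. transpose (mat_power A k /\<^sub>R fact k)) sums transpose (mat_exp A)"
    by (rule bounded_linear.sums[OF _ mat_exp_sums])
      (simp add: linear_transpose linear_conv_bounded_linear[symmetric])
  then have "(\<lambda>k. mat_power A k /\<^sub>R fact k) sums transpose (mat_exp A)"
    by (simp add: linear_cmul[OF linear_transpose] transpose_mat_power[OF assms])
  then show ?thesis
    using mat_exp_sums sums_unique2 by blast
qed

text \<open>Puts each coordinate in the form of a real power series in \<open>t\<close>, so that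
  scalar termwise differentiation applies.\<close>

lemma trajectory_sums:
  fixes A :: "real^'n^'n"
  shows "(\<lambda>k. (mat_power A k *v x0) $ i / fact k * t ^ k) sums (trajectory A x0 t $ i)"
proof -
  have lin: "linear (\<lambda>M :: real^'n^'n. (M *v x0) $ i)"
    by (rule linearI) (simp_all add: matrix_vector_mult_add_rdistrib scaleR_matrix_vector_assoc[symmetric])
  have "(\<lambda>k. (((mat_power (t *\<^sub>R A) k /\<^sub>R fact k)) *v x0) $ i) sums ((mat_exp (t *\<^sub>R A) *v x0) $ i)"
    by (rule bounded_linear.sums[OF _ mat_exp_sums])
      (simp add: lin linear_conv_bounded_linear[symmetric])
  moreover have "(((mat_power (t *\<^sub>R A) k /\<^sub>R fact k)) *v x0) $ i
      = (mat_power A k *v x0) $ i / fact k * t ^ k" for k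
    by (simp add: mat_power_scaleR linear_cmul[OF lin] field_simps)
  ultimately show ?thesis
    by (simp add: trajectory_def)
qed

lemma trajectory_0: "trajectory A x0 0 = x0"
proof -
  have "trajectory A x0 0 $ i = x0 $ i" for i
    using sums_unique2[OF trajectory_sums[of A x0 i 0] powser_sums_zero] by (simp add: mat_power_def)
  then show ?thesis
    by (simp add: vec_eq_iff)
qed

lemma has_vector_derivative_trajectory:
  fixes A :: "real^'n^'n"
  shows "(trajectory A x0 has_vector_derivative A *v trajectory A x0 t) (at t within I)"
proof -
  have deriv: "((\<lambda>s. trajectory A x0 s $ i) has_vector_derivative (A *v trajectory A x0 t) $ i) (at t)"
    for i
  proof -
    define c where "c = (\<lambda>k. (mat_power A k *v x0) $ i / fact k)"
    have sums: "(\<lambda>k. c k * s ^ k) sums (trajectory A x0 s $ i)" for s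
      unfolding c_def by (rule trajectory_sums)
    have "((\<lambda>s. \<Sum>k. c k * s ^ k) has_field_derivative (\<Sum>k. diffs c k * t ^ k)) (at t)"
      by (rule termdiffs_strong_converges_everywhere) (rule sums_summable[OF sums])
    moreover have "(\<lambda>s. \<Sum>k. c k * s ^ k) = (\<lambda>s. trajectory A x0 s $ i)"
      using sums by (simp add: sums_iff)
    moreover have "(\<lambda>k. diffs c k * t ^ k) sums ((A *v trajectory A x0 t) $ i)"
    proof -
      have "diffs c k * t ^ k
          = (\<Sum>j\<in>UNIV. A $ i $ j * ((mat_power A k *v x0) $ j / fact k * t ^ k))" for k
      proof -
        \<comment> \<open>The factor \<open>Suc k\<close> produced by \<open>diffs\<close> cancels
          against \<open>fact (Suc k)\<close>, and one \<open>A\<close> splits off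
          \<open>mat_power A (Suc k)\<close>; \<open>of_nat_Suc\<close> would expand that factor
          before it cancels.\<close>
        have "diffs c k = (A *v (mat_power A k *v x0)) $ i / fact k"
          by (simp add: diffs_def c_def mat_power_Suc matrix_vector_mul_assoc del: of_nat_Suc)
        then show ?thesis
          by (simp add: matrix_vector_mult_def[of A] sum_distrib_left sum_divide_distrib sum_distrib_right mult.assoc)
      qed
      moreover have "(\<lambda>k. \<Sum>j\<in>UNIV. A $ i $ j * ((mat_power A k *v x0) $ j / fact k * t ^ k))
          sums (\<Sum>j\<in>UNIV. A $ i $ j * trajectory A x0 t $ j)"
        by (intro sums_sum sums_mult trajectory_sums)
      ultimately show ?thesis
        by (simp add: matrix_vector_mult_def)
    qed
    ultimately show ?thesis
      by (simp add: sums_iff has_real_derivative_iff_has_vector_derivative)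
  qed
  have "(trajectory A x0 has_vector_derivative A *v trajectory A x0 t) (at t)"
    unfolding has_vector_derivative_def
  proof (subst has_derivative_componentwise_within, rule ballI)
    fix b :: "real^'n" assume "b \<in> Basis"
    then obtain i where b: "b = axis i 1"
      by (auto simp: Basis_vec_def)
    show "((\<lambda>s. trajectory A x0 s \<bullet> b) has_derivative
        (\<lambda>h. (h *\<^sub>R (A *v trajectory A x0 t)) \<bullet> b)) (at t)"
      using deriv[of i] by (simp add: b inner_axis has_vector_derivative_def)
  qed
  then show ?thesis
    by (rule has_vector_derivative_at_within)
qed

lemma matrix_mul_outer: "A ** outer v w = outer (A *v v) w"
  by (simp add: outer_def matrix_matrix_mult_def matrix_vector_mult_def vec_eq_iff
      sum_distrib_right mult.assoc)

lemma outer_matrix_mul: "outer v w ** A = outer v (transpose A *v w)"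
  by (simp add: outer_def matrix_matrix_mult_def matrix_vector_mult_def transpose_def vec_eq_iff
      sum_distrib_left mult_ac)

text \<open>The inner product of \<open>real^'n^'n\<close> is the Frobenius product, so pairing with
  a rank-one matrix evaluates the bilinear form of \<open>D\<close>.\<close>

lemma inner_outer: "D \<bullet> outer v w = v \<bullet> (D *v w)"
  by (simp add: inner_vec_def outer_def matrix_vector_mult_def sum_distrib_left mult_ac)

lemma bounded_bilinear_outer:
  "bounded_bilinear (outer :: real^'n \<Rightarrow> real^'n \<Rightarrow> real^'n^'n)"
  unfolding bilinear_conv_bounded_bilinear[symmetric] bilinear_def
  by (auto intro!: linearI simp: outer_def vec_eq_iff algebra_simps)

text \<open>Allows the Lyapunov operator to be moved through the integral that defines the
  Gramian.\<close>

lemma bounded_linear_lyapunov: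
  fixes A :: "real^'n^'n"
  shows "bounded_linear (\<lambda>M. A ** M + M ** A)"
  unfolding linear_conv_bounded_linear[symmetric]
  by (rule linearI)
    (simp_all add: vec_eq_iff matrix_matrix_mult_def algebra_simps sum.distrib sum_distrib_left)

lemma gramian_integrable:
  fixes x :: "real \<Rightarrow> real^'n"
  assumes "continuous_on {a..b} x"
  shows "(\<lambda>t. outer (x t) (x t)) integrable_on {a..b}"
  by (intro integrable_continuous_real bounded_bilinear.continuous_on[OF bounded_bilinear_outer] assms)

lemma lyapunov_gramian:
  fixes x :: "real \<Rightarrow> real^'n"
  assumes "a \<le> b" and sym: "transpose A = A" and sol: "solves_on x A {a..b}"
  defines "P \<equiv> integral {a..b} (\<lambda>t. outer (x t) (x t))"
  shows "A ** P + P ** A = outer (x b) (x b) - outer (x a) (x a)"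
proof -
  have cont: "continuous_on {a..b} x"
    using sol by (auto simp: solves_on_def intro: continuous_on_vector_derivative)
  have "((\<lambda>t. outer (x t) (A *v x t) + outer (A *v x t) (x t)) has_integral
      outer (x b) (x b) - outer (x a) (x a)) {a..b}"
  proof (rule fundamental_theorem_of_calculus[OF \<open>a \<le> b\<close>])
    fix t assume "t \<in> {a..b}"
    then have d: "(x has_vector_derivative A *v x t) (at t within {a..b})"
      using sol by (simp add: solves_on_def)
    show "((\<lambda>t. outer (x t) (x t)) has_vector_derivative
        outer (x t) (A *v x t) + outer (A *v x t) (x t)) (at t within {a..b})"
      by (rule bounded_bilinear.has_vector_derivative[OF bounded_bilinear_outer d d])
  qed
  then have 1: "((\<lambda>t. A ** outer (x t) (x t) + outer (x t) (x t) ** A) has_integral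
      outer (x b) (x b) - outer (x a) (x a)) {a..b}"
    by (simp add: matrix_mul_outer outer_matrix_mul sym add.commute)
  \<comment> \<open>The integral in \<open>1\<close> is evaluated a second time, now by pulling the
    Lyapunov operator out; comparing the two values gives the equation.\<close>
  have 2: "((\<lambda>t. A ** outer (x t) (x t) + outer (x t) (x t) ** A) has_integral
      A ** P + P ** A) {a..b}"
    using has_integral_linear[OF integrable_integral[OF gramian_integrable[OF cont]]
        bounded_linear_lyapunov[of A]]
    by (simp add: P_def o_def)
  show ?thesis
    by (rule has_integral_unique[OF 2 1])
qed

lemma lyapunov_gramian_kernel:
  fixes x :: "real \<Rightarrow> real^'n"
  assumes "a < b" and sym: "transpose D = D" and cont: "continuous_on {a..b} x"
  defines "P \<equiv> integral {a..b} (\<lambda>t. outer (x t) (x t))"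
  assumes eq: "D ** P + P ** D = 0" and t: "t \<in> {a..b}"
  shows "D *v x t = 0"
proof -
  have "bounded_linear (\<lambda>M. D \<bullet> (D ** M + M ** D))"
    by (rule bounded_linear_compose[OF bounded_linear_inner_right bounded_linear_lyapunov])
  then have "((\<lambda>t. D \<bullet> (D ** outer (x t) (x t) + outer (x t) (x t) ** D)) has_integral
      D \<bullet> (D ** P + P ** D)) {a..b}"
    using has_integral_linear[OF integrable_integral[OF gramian_integrable[OF cont]]]
    by (fastforce simp: P_def o_def)
  moreover have "D \<bullet> (D ** outer (x t) (x t) + outer (x t) (x t) ** D) = 2 * (norm (D *v x t))\<^sup>2" for t
  proof -
    \<comment> \<open>The summand with \<open>D\<close> on the right pairs to this expression;
      symmetry moves one \<open>D\<close> across. The other summand gives the same squared norm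
      directly.\<close>
    have "x t \<bullet> (D *v (D *v x t)) = (D *v x t) \<bullet> (D *v x t)"
      using dot_lmul_matrix[of "x t" D "D *v x t"] transpose_matrix_vector[of D "x t"] sym by simp
    then show ?thesis
      by (simp add: matrix_mul_outer outer_matrix_mul sym inner_add_right inner_outer power2_norm_eq_inner)
  qed
  ultimately have int: "((\<lambda>t. 2 * (norm (D *v x t))\<^sup>2) has_integral 0) (cbox a b)"
    by (simp add: eq)
  \<comment> \<open>A continuous nonnegative integrand with integral zero vanishes at every point,
    endpoints included; \<open>a < b\<close> keeps the open interval nonempty.\<close>
  have "2 * (norm (D *v x t))\<^sup>2 = 0"
  proof (rule has_integral_0_cbox_imp_0[OF _ _ int])
    show "continuous_on (cbox a b) (\<lambda>t. 2 * (norm (D *v x t))\<^sup>2)"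
      using cont by (auto intro!: continuous_intros matrix_vector_mult_linear_continuous_on[THEN continuous_on_compose2])
  qed (use t \<open>a < b\<close> in auto)
  then show ?thesis by simp
qed

theorem theorem7:
  fixes T :: real
    and G :: "('n::finite \<times> 'n) set"
    and K :: "('n \<times> 'n) set \<Rightarrow> (real^'n^'n) set"
    and X P Q :: "real^'n^'n"
    and x0 xT :: "real^'n"
  assumes "T > 0"
    and "G \<in> simple_graphs"
    and "\<forall>H\<in>simple_graphs. K H \<noteq> {} \<and> K H \<subseteq> qualitative_class H"
    and "X \<in> K G"
    and "P = integral {0..T} (\<lambda>t. mat_exp (t *\<^sub>R X) ** outer x0 x0 ** mat_exp (t *\<^sub>R X))"
    and "xT = mat_exp (T *\<^sub>R X) *v x0"
    and "Q = outer xT xT - outer x0 x0"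
  shows "(solvable T x0 X K \<longleftrightarrow> (\<exists>!S. S ** P + P ** S = Q \<and> S \<in> im K)) \<and>
    ((\<exists>!S. S ** P + P ** S = Q \<and> S \<in> im K) \<longrightarrow>
      (\<forall>S. S ** P + P ** S = Q \<and> S \<in> im K \<longrightarrow> S = X))"
proof -
  have symK: "transpose S = S" if "S \<in> im K" for S
    using that by (simp add: im_def symmetric_matrices_def)
  \<comment> \<open>Membership in the class supplies the symmetry that \<open>im\<close> demands of
    \<open>X\<close>.\<close>
  have "X \<in> qualitative_class G"
    using assms(2-4) by blast
  then have XK: "X \<in> im K"
    using assms(2,4) by (auto simp: im_def qualitative_class_def)
  have symX: "transpose X = X"
    by (rule symK[OF XK])
  let ?x = "trajectory X x0"
  have cont: "continuous_on {0..T} ?x"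
    by (rule continuous_on_vector_derivative) (rule has_vector_derivative_trajectory)
  \<comment> \<open>By symmetry of the exponential, the right factor
    \<open>mat_exp (t *\<^sub>R X)\<close> acts on the second copy of \<open>x0\<close> without a
    transpose.\<close>
  have P: "P = integral {0..T} (\<lambda>t. outer (?x t) (?x t))"
    by (simp add: assms(5) trajectory_def matrix_mul_outer outer_matrix_mul transpose_mat_exp
        linear_cmul[OF linear_transpose] symX)
  have Q: "Q = outer (?x T) (?x T) - outer (?x 0) (?x 0)"
    unfolding assms(6,7) trajectory_0 by (simp add: trajectory_def)
  have lyapunov: "S ** P + P ** S = Q" if "S \<in> im K" "solves_on ?x S {0..T}" for S
    unfolding P Q using lyapunov_gramian[of 0 T S ?x] that symK \<open>T > 0\<close> by simp
  have solX: "solves_on ?x X {0..T}"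
    by (simp add: solves_on_def has_vector_derivative_trajectory)
  have converse: "solves_on ?x S {0..T}" if S: "S \<in> im K" and eq: "S ** P + P ** S = Q" for S
  proof -
    have sym: "transpose (S - X) = S - X"
      by (simp add: linear_diff[OF linear_transpose] symK[OF S] symX)
    have "(S - X) ** P + P ** (S - X) = (S ** P + P ** S) - (X ** P + P ** X)"
      by (simp add: vec_eq_iff matrix_matrix_mult_def algebra_simps sum_subtractf)
    also have "\<dots> = 0"
      using eq lyapunov[OF XK solX] by simp
    finally have "(S - X) *v ?x t = 0" if "t \<in> {0..T}" for t
      using lyapunov_gramian_kernel[OF \<open>T > 0\<close> sym cont _ that] by (simp add: P)
    then show ?thesis
      using solX by (simp add: solves_on_def matrix_vector_mult_diff_rdistrib)
  qed
  have "solvable T x0 X K \<longleftrightarrow> (\<forall>S. S ** P + P ** S = Q \<and> S \<in> im K \<longrightarrow> S = X)"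
    unfolding solvable_def using lyapunov converse by blast
  \<comment> \<open>\<open>X\<close> itself solves the equation and lies in \<open>im K\<close>, so
    unique existence amounts to every solution being \<open>X\<close>.\<close>
  then show ?thesis
    using lyapunov[OF XK solX] XK by blast
qed

end
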